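(* Let $S(\cdot\mid \mathsf{sk})$ denote the detection test statistic computed with secret key $\mathsf{sk}$. Under the null hypothesis $H_0$, given a random text $x_{1:n}$, let $$\Pr\big(S(x_{1:n}\mid \mathsf{sk}_0)-\mathbb{E}_{H_0}[S]\ge t \,\big|\, H_0\big)=p_0(t),$$ i.e. $p_0(t)$ is the false positive rate of threshold $t$ under detection with a single secret key. Given $M$ different secret keys $\mathsf{sk}_1,\dots,\mathsf{sk}_M$, if the maximum of the scores is used as the test statistic, then $$\Pr\Big(\max_{i\in\{1,\dots,M\}}\big(S(x_{1:n}\mid \mathsf{sk}_i)-\mathbb{E}_{H_0}[S]\big)\ge t\,\Big|\,H_0\Big)=1-(1-p_0(t))^M\qquad\text{for all } t\in\mathbb{R}.$$
   Context: A text $x_{1:n}=(x_1,\dots,x_n)$ is a sequence of tokens from a finite token set. A watermark is embedded by a pseudo-random rule $F$ that adjusts the language model's next-token distribution and is seeded by watermark keys $k$; a watermark key usually consists of a secret key $\mathsf{sk}$ and a context key (such as the preceding n-gram or the token position). Detection is a hypothesis test: $H_0$ is the hypothesis that the content is generated without the presence of watermarks, $H_1$ that it is generated with the presence of watermarks. The test statistic is $S(x_{1:n})=\sum_{i=1}^n s(x_i,k,F)$ for a real-valued score function $s$, and $S(x_{1:n}\mid\mathsf{sk})$ is this statistic when the secret key is $\mathsf{sk}$. $\mathbb{E}_{H_0}[S]$ is the expected value of the test statistic under $H_0$. The null hypothesis is rejected when $S-\mathbb{E}_{H_0}[S]$ is at least the threshold $t$.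
   Formalization: Adds that different secret keys give independent, identically distributed seeds and that the false positive rate given each possible text is the same p_0(t); without these the formula fails, e.g. when scores depend on the text but not on the key. *)

theory Defs
  imports "HOL-Probability.Probability"
begin

text \<open>A watermark key is a pair of a secret key and a context key.\<close>

type_synonym ('sk, 'ctx) wkey = "'sk \<times> 'ctx"

text \<open>The watermark rule turns a pseudo-random seed and the next-token distribution of the
  language model into the adjusted next-token distribution.\<close>

type_synonym ('r, 'tok) wrule = "'r \<Rightarrow> 'tok pmf \<Rightarrow> 'tok pmf"

text \<open>The statistic \<open>S(x | sk)\<close>, the sum of the scores \<open>s(x_i, k_i, F)\<close> with
  \<open>k_i = (sk, ctx (x_1, ..., x_{i-1}))\<close>.  The context key is a function of the preceding tokens,
  which covers n-grams as well as the token position (the length of the prefix).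
  \<open>G k \<omega>\<close> is the pseudo-random seed produced by the watermark key \<open>k\<close>; the score sees \<open>k\<close>
  through this seed.  List indices start at 0.\<close>

definition test_stat ::
  "('tok \<Rightarrow> 'r \<Rightarrow> ('r, 'tok) wrule \<Rightarrow> real) \<Rightarrow> ('r, 'tok) wrule \<Rightarrow> ('tok list \<Rightarrow> 'ctx) \<Rightarrow>
   (('sk, 'ctx) wkey \<Rightarrow> 'w \<Rightarrow> 'r) \<Rightarrow> 'tok list \<Rightarrow> 'sk \<Rightarrow> 'w \<Rightarrow> real"
  where
  "test_stat s F ctx G x sk \<omega> = (\<Sum>i<length x. s (x ! i) (G (sk, ctx (take i x)) \<omega>) F)"

text \<open>Idealised pseudo-randomness: different secret keys give independent, identically
  distributed families of seeds, indexed by the context keys.  Seeds of the same secret key at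
  different context keys may depend on each other.\<close>

definition ideal_seeding ::
  "'w measure \<Rightarrow> 'r measure \<Rightarrow> (('sk, 'ctx) wkey \<Rightarrow> 'w \<Rightarrow> 'r) \<Rightarrow> bool"
  where
  "ideal_seeding P R G \<longleftrightarrow>
     prob_space.indep_vars P (\<lambda>_. \<Pi>\<^sub>M c\<in>UNIV. R) (\<lambda>sk \<omega> c. G (sk, c) \<omega>) UNIV \<and>
     (\<forall>sk sk'. distr P (\<Pi>\<^sub>M c\<in>UNIV. R) (\<lambda>\<omega> c. G (sk, c) \<omega>) =
               distr P (\<Pi>\<^sub>M c\<in>UNIV. R) (\<lambda>\<omega> c. G (sk', c) \<omega>))"

text \<open>\<open>H\<^sub>0\<close>: the text of length \<open>n\<close> is generated without the watermark, i.e. independently of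
  the whole pseudo-random seeding.  Nothing is assumed about the law of the text.  The two random
  variables have values of different types, so independence is stated through the
  \<open>\<sigma>\<close>-algebras they generate (\<open>indep_var\<close> needs equal types).\<close>

definition null_hypothesis ::
  "'w measure \<Rightarrow> 'r measure \<Rightarrow> (('sk, 'ctx) wkey \<Rightarrow> 'w \<Rightarrow> 'r) \<Rightarrow> nat \<Rightarrow> ('w \<Rightarrow> 'tok list) \<Rightarrow> bool"
  where
  "null_hypothesis P R G n X \<longleftrightarrow>
     X \<in> P \<rightarrow>\<^sub>M count_space UNIV \<and>
     (\<lambda>\<omega> k. G k \<omega>) \<in> P \<rightarrow>\<^sub>M (\<Pi>\<^sub>M k\<in>UNIV. R) \<and>
     prob_space.indep_set P
       {X -` A \<inter> space P | A. A \<in> sets (count_space UNIV)}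
       {(\<lambda>\<omega> k. G k \<omega>) -` B \<inter> space P | B. B \<in> sets (\<Pi>\<^sub>M k\<in>UNIV. R)} \<and>
     (\<forall>\<omega>\<in>space P. length (X \<omega>) = n)"

end

theory Submission
  imports Defs
begin

text \<open>Condition on the text. Given \<open>X = x\<close>, the scores under distinct secret keys are independent
  and identically distributed, because the text is independent of the seeding; so the maximum stays
  below \<open>t\<close> with probability \<open>(1 - p\<^sub>0 t) ^ M\<close>. The assumption that the false positive rate given
  the text is \<open>p\<^sub>0 t\<close> makes this value the same for all texts, and it survives averaging over the
  finitely many texts of length \<open>n\<close>.\<close>

text \<open>Each event is the preimage of one fixed measurable set, so independence turns the
  probability of the intersection into a product, and equality of the laws makes all factors equal.
  The reference index \<open>k\<close> need not lie in \<open>J\<close>.\<close>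

lemma (in prob_space) prob_ball_iid:
  assumes indep: "indep_vars (\<lambda>_. N) Z UNIV"
    and distr: "\<And>j. distr M N (Z j) = distr M N (Z k)"
    and A: "{y \<in> space N. Q y} \<in> sets N"
    and J: "finite J" "J \<noteq> {}"
  shows "\<P>(\<omega> in M. \<forall>j\<in>J. Q (Z j \<omega>)) = \<P>(\<omega> in M. Q (Z k \<omega>)) ^ card J"
proof -
  have rv: "Z j \<in> M \<rightarrow>\<^sub>M N" for j
    using indep by (auto simp: indep_vars_def)
  have vim: "Z j -` {y \<in> space N. Q y} \<inter> space M = {\<omega> \<in> space M. Q (Z j \<omega>)}" for j
    using measurable_space[OF rv] by auto
  have same: "\<P>(\<omega> in M. Q (Z j \<omega>)) = \<P>(\<omega> in M. Q (Z k \<omega>))" for j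
    using measure_distr[OF rv[of j] A] measure_distr[OF rv[of k] A] distr[of j]
    by (metis vim)
  have "\<P>(\<omega> in M. \<forall>j\<in>J. Q (Z j \<omega>)) =
      prob (\<Inter>j\<in>J. Z j -` {y \<in> space N. Q y} \<inter> space M)"
    \<comment> \<open>\<open>J\<close> is nonempty here: an empty intersection would be
      \<open>UNIV\<close> instead of \<open>space M\<close>.\<close>
    using J(2) by (simp only: vim) (auto intro!: arg_cong[where f = prob])
  also have "\<dots> = (\<Prod>j\<in>J. prob (Z j -` {y \<in> space N. Q y} \<inter> space M))"
    using A by (intro indep_varsD[OF indep J(2,1)]) auto
  also have "\<dots> = (\<Prod>j\<in>J. \<P>(\<omega> in M. Q (Z k \<omega>)))"
    unfolding vim by (intro prod.cong refl same)
  also have "\<dots> = \<P>(\<omega> in M. Q (Z k \<omega>)) ^ card J"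
    by simp
  finally show ?thesis .
qed

text \<open>This is the tool for freezing the text. \<open>Q\<close> concerns the seeds alone but
  may be chosen after \<open>x\<close> is fixed, so on \<open>X \<omega> = x\<close> a condition on
  the score of the random text becomes one on the score of \<open>x\<close>, and the probability of
  \<open>X \<omega> = x\<close> splits off.\<close>

lemma (in prob_space) null_hypothesis_prob_mult:
  assumes H0: "null_hypothesis M R G n X"
    and B: "{y \<in> space (\<Pi>\<^sub>M k\<in>UNIV. R). Q y} \<in> sets (\<Pi>\<^sub>M k\<in>UNIV. R)"
  shows "\<P>(\<omega> in M. X \<omega> = x \<and> Q (\<lambda>k. G k \<omega>)) = \<P>(\<omega> in M. X \<omega> = x) * \<P>(\<omega> in M. Q (\<lambda>k. G k \<omega>))"
    and "{\<omega> \<in> space M. X \<omega> = x \<and> Q (\<lambda>k. G k \<omega>)} \<in> events"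
proof -
  let ?N = "\<Pi>\<^sub>M k\<in>UNIV. R" and ?G = "\<lambda>\<omega> k. G k \<omega>"
  let ?B = "{y \<in> space ?N. Q y}"
  have G: "?G \<in> M \<rightarrow>\<^sub>M ?N" and X: "X \<in> M \<rightarrow>\<^sub>M count_space UNIV"
    and ind: "indep_set {X -` A \<inter> space M |A. A \<in> sets (count_space UNIV)}
      {?G -` B \<inter> space M |B. B \<in> sets ?N}"
    using H0 by (auto simp: null_hypothesis_def)
  have vX: "X -` {x} \<inter> space M = {\<omega> \<in> space M. X \<omega> = x}"
    by auto
  have vG: "?G -` ?B \<inter> space M = {\<omega> \<in> space M. Q (?G \<omega>)}"
    using measurable_space[OF G] by auto
  have Int: "{\<omega> \<in> space M. X \<omega> = x \<and> Q (?G \<omega>)} = (X -` {x} \<inter> space M) \<inter> (?G -` ?B \<inter> space M)"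
    unfolding vX vG by auto
  have A': "X -` {x} \<inter> space M \<in> {X -` A \<inter> space M |A. A \<in> sets (count_space UNIV)}"
    by auto
  have B': "?G -` ?B \<inter> space M \<in> {?G -` B \<inter> space M |B. B \<in> sets ?N}"
    using B by blast
  have "prob ((X -` {x} \<inter> space M) \<inter> (?G -` ?B \<inter> space M)) =
      prob (X -` {x} \<inter> space M) * prob (?G -` ?B \<inter> space M)"
    by (rule indep_setD[OF ind A' B'])
  then show "\<P>(\<omega> in M. X \<omega> = x \<and> Q (?G \<omega>)) = \<P>(\<omega> in M. X \<omega> = x) * \<P>(\<omega> in M. Q (?G \<omega>))"
    unfolding Int vX vG .
  show "{\<omega> \<in> space M. X \<omega> = x \<and> Q (?G \<omega>)} \<in> events"
    unfolding Int by (intro sets.Int measurable_sets[OF X] measurable_sets[OF G] B) simp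
qed

theorem theorem4p1:
  fixes P :: "'w measure"
    and R :: "'r measure"
    and G :: "('sk, 'ctx) wkey \<Rightarrow> 'w \<Rightarrow> 'r"
    and F :: "('r, 'tok::finite) wrule"
    and s :: "'tok \<Rightarrow> 'r \<Rightarrow> ('r, 'tok) wrule \<Rightarrow> real"
    and ctx :: "'tok list \<Rightarrow> 'ctx"
    and X :: "'w \<Rightarrow> 'tok list"
    and S :: "'tok list \<Rightarrow> 'sk \<Rightarrow> 'w \<Rightarrow> real"
    and n M :: nat
    and sk\<^sub>0 :: 'sk
    and sk :: "nat \<Rightarrow> 'sk"
    and ES :: real
    and p\<^sub>0 :: "real \<Rightarrow> real"
  assumes "prob_space P"
    and score_measurable: "\<And>x. (\<lambda>r. s x r F) \<in> borel_measurable R"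
    and seeding: "ideal_seeding P R G"
    and H0: "null_hypothesis P R G n X"
    and S: "S = test_stat s F ctx G"
    and S_integrable: "integrable P (\<lambda>\<omega>. S (X \<omega>) sk\<^sub>0 \<omega>)"
    and ES: "ES = prob_space.expectation P (\<lambda>\<omega>. S (X \<omega>) sk\<^sub>0 \<omega>)"
    and p0: "\<And>t. \<P>(\<omega> in P. S (X \<omega>) sk\<^sub>0 \<omega> - ES \<ge> t) = p\<^sub>0 t"
    and p0_given_text: "\<And>t x. \<P>(\<omega> in P. X \<omega> = x) > 0 \<Longrightarrow>
          \<P>(\<omega> in P. S (X \<omega>) sk\<^sub>0 \<omega> - ES \<ge> t \<bar> X \<omega> = x) = p\<^sub>0 t"
    and "M \<ge> 1"
    and different_keys: "inj_on sk {1..M}"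
  shows "\<forall>t. \<P>(\<omega> in P. Max ((\<lambda>i. S (X \<omega>) (sk i) \<omega> - ES) ` {1..M}) \<ge> t)
             = 1 - (1 - p\<^sub>0 t) ^ M"
proof
  fix t :: real
  interpret prob_space P by fact
  let ?C = "\<Pi>\<^sub>M c\<in>(UNIV :: 'ctx set). R"
  let ?N = "\<Pi>\<^sub>M k\<in>(UNIV :: ('sk, 'ctx) wkey set). R"
  \<comment> \<open>Here \<open>y\<close> is the family of seeds of a single secret key, the object
    whose independence across keys \<open>ideal_seeding\<close> provides.\<close>
  define h where "h x y = (\<Sum>i<length x. s (x ! i) (y (ctx (take i x))) F)"
    for x :: "'tok list" and y :: "'ctx \<Rightarrow> 'r"
  have S_h: "S x k \<omega> = h x (\<lambda>c. G (k, c) \<omega>)" for x k \<omega>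
    by (simp add: S test_stat_def h_def)
  have h_meas [measurable]: "h x \<in> borel_measurable ?C" for x
    unfolding h_def
    by (intro borel_measurable_sum measurable_compose[OF measurable_component_singleton]
        score_measurable) auto
  \<comment> \<open>The null hypothesis lives on \<open>?N\<close> (seeds of all keys), the i.i.d.
    assumption on \<open>?C\<close> (seeds of one secret key); fixing the secret key maps the first
    to the second.\<close>
  have section_meas: "(\<lambda>y c. y (k, c)) \<in> ?N \<rightarrow>\<^sub>M ?C" for k :: 'sk
    by (intro measurable_PiM_single' measurable_component_singleton) (auto simp: space_PiM)
  have h_section_meas [measurable]: "(\<lambda>y. h x (\<lambda>c. y (k, c))) \<in> borel_measurable ?N"
    for x and k :: 'sk
    by (rule measurable_compose[OF section_meas h_meas])
  have X: "X \<in> P \<rightarrow>\<^sub>M count_space UNIV" and len: "\<And>\<omega>. \<omega> \<in> space P \<Longrightarrow> length (X \<omega>) = n"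
    using H0 by (auto simp: null_hypothesis_def)
  have X_events: "{\<omega> \<in> space P. X \<omega> = x} \<in> events" for x
    using measurable_sets[OF X, of "{x}"] by (simp add: vimage_def Int_def conj_commute)
  \<comment> \<open>There are only finitely many tokens, so averaging over the texts is a finite
    sum.\<close>
  define T where "T = {x :: 'tok list. length x = n}"
  have fin: "finite T"
    using finite_lists_length_eq[of "UNIV :: 'tok set" n] by (simp add: T_def)
  \<comment> \<open>Independence is indexed by secret keys, so the positions are replaced by the
    keys themselves; injectivity of \<open>sk\<close> keeps the exponent at
    \<open>M\<close>.\<close>
  define J where "J = sk ` {1..M}"
  have J: "finite J" "J \<noteq> {}" "card J = M"
    using \<open>M \<ge> 1\<close> different_keys by (auto simp: J_def card_image)
  let ?below = "\<lambda>x \<omega>. \<forall>k\<in>J. h x (\<lambda>c. G (k, c) \<omega>) - ES < t"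

  \<comment> \<open>The joint form, unlike a conditional probability, can be summed over all of
    \<open>T\<close>, including texts of probability zero.\<close>
  have below: "\<P>(\<omega> in P. X \<omega> = x \<and> ?below x \<omega>) = \<P>(\<omega> in P. X \<omega> = x) * (1 - p\<^sub>0 t) ^ M"
    and below_events: "{\<omega> \<in> space P. X \<omega> = x \<and> ?below x \<omega>} \<in> events" for x
  proof -
    have "{y \<in> space ?N. \<forall>k\<in>J. h x (\<lambda>c. y (k, c)) - ES < t} \<in> sets ?N"
      using J(1) by measurable
    note mult = null_hypothesis_prob_mult[OF H0 this, of x]
    show "{\<omega> \<in> space P. X \<omega> = x \<and> ?below x \<omega>} \<in> events"
      by (rule mult(2))
    show "\<P>(\<omega> in P. X \<omega> = x \<and> ?below x \<omega>) = \<P>(\<omega> in P. X \<omega> = x) * (1 - p\<^sub>0 t) ^ M"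
    proof (cases "\<P>(\<omega> in P. X \<omega> = x) > 0")
      case True
      have "{y \<in> space ?N. h x (\<lambda>c. y (sk\<^sub>0, c)) - ES < t} \<in> sets ?N"
        by measurable
      note mult0 = null_hypothesis_prob_mult[OF H0 this, of x]
      \<comment> \<open>The conditional rate is multiplied out, complemented inside the event
        \<open>X \<omega> = x\<close>, and factored by \<open>mult0\<close>. Cancelling the positive
        probability of \<open>x\<close> leaves \<open>single\<close>, an unconditional statement
        about the fixed text \<open>x\<close>.\<close>
      have "\<P>(\<omega> in P. S (X \<omega>) sk\<^sub>0 \<omega> - ES \<ge> t \<and> X \<omega> = x) = p\<^sub>0 t * \<P>(\<omega> in P. X \<omega> = x)"
        using p0_given_text[OF True, of t] True by (simp add: cond_prob_def field_simps)
      also have "{\<omega> \<in> space P. S (X \<omega>) sk\<^sub>0 \<omega> - ES \<ge> t \<and> X \<omega> = x} = {\<omega> \<in> space P. X \<omega> = x} -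
          {\<omega> \<in> space P. X \<omega> = x \<and> h x (\<lambda>c. G (sk\<^sub>0, c) \<omega>) - ES < t}"
        by (auto simp: S_h)
      also have "prob \<dots> = \<P>(\<omega> in P. X \<omega> = x) -
          \<P>(\<omega> in P. X \<omega> = x) * \<P>(\<omega> in P. h x (\<lambda>c. G (sk\<^sub>0, c) \<omega>) - ES < t)"
        unfolding mult0(1)[symmetric] using X_events mult0(2)
        by (intro finite_measure_Diff) auto
      finally have "\<P>(\<omega> in P. X \<omega> = x) * \<P>(\<omega> in P. h x (\<lambda>c. G (sk\<^sub>0, c) \<omega>) - ES < t) =
          \<P>(\<omega> in P. X \<omega> = x) * (1 - p\<^sub>0 t)"
        by (simp add: algebra_simps)
      then have single: "\<P>(\<omega> in P. h x (\<lambda>c. G (sk\<^sub>0, c) \<omega>) - ES < t) = 1 - p\<^sub>0 t"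
        using True by simp
      \<comment> \<open>\<open>sk\<^sub>0\<close> serves as the reference for the common law of the
        seed families.\<close>
      have "\<P>(\<omega> in P. ?below x \<omega>) = \<P>(\<omega> in P. h x (\<lambda>c. G (sk\<^sub>0, c) \<omega>) - ES < t) ^ card J"
      proof (rule prob_ball_iid[where Q = "\<lambda>y. h x y - ES < t" and Z = "\<lambda>k \<omega> c. G (k, c) \<omega>"
            and N = ?C])
        show "indep_vars (\<lambda>_. ?C) (\<lambda>k \<omega> c. G (k, c) \<omega>) UNIV"
          using seeding by (simp add: ideal_seeding_def)
        show "distr P ?C (\<lambda>\<omega> c. G (k, c) \<omega>) = distr P ?C (\<lambda>\<omega> c. G (sk\<^sub>0, c) \<omega>)" for k
          using seeding unfolding ideal_seeding_def by blast
        show "{y \<in> space ?C. h x y - ES < t} \<in> sets ?C"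
          by measurable
      qed (use J in auto)
      then show ?thesis
        using mult(1) by (simp add: single J(3))
    next
      \<comment> \<open>The text has probability zero, so both sides vanish by the product
        formula.\<close>
      case False
      then show ?thesis
        using mult(1) by (simp add: zero_less_measure_iff)
    qed
  qed

  have "(\<Sum>x\<in>T. \<P>(\<omega> in P. X \<omega> = x)) = prob (\<Union>x\<in>T. {\<omega> \<in> space P. X \<omega> = x})"
    using fin X_events
    by (intro finite_measure_finite_Union[symmetric]) (auto simp: disjoint_family_on_def)
  also have "(\<Union>x\<in>T. {\<omega> \<in> space P. X \<omega> = x}) = space P"
    using len by (auto simp: T_def)
  finally have total: "(\<Sum>x\<in>T. \<P>(\<omega> in P. X \<omega> = x)) = 1"
    by (simp add: prob_space)

  \<comment> \<open>The event that all \<open>M\<close> centred scores stay below \<open>t\<close>,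
    split according to the value of the text.\<close>
  let ?E = "\<Union>x\<in>T. {\<omega> \<in> space P. X \<omega> = x \<and> ?below x \<omega>}"
  have "prob ?E = (\<Sum>x\<in>T. \<P>(\<omega> in P. X \<omega> = x \<and> ?below x \<omega>))"
    using fin below_events
    by (intro finite_measure_finite_Union) (auto simp: disjoint_family_on_def)
  also have "\<dots> = (1 - p\<^sub>0 t) ^ M"
    by (simp add: below total flip: sum_distrib_right)
  finally have prob_E: "prob ?E = (1 - p\<^sub>0 t) ^ M" .

  \<comment> \<open>Since \<open>M \<ge> 1\<close>, the maximum is over a nonempty set, so it
    reaches \<open>t\<close> exactly when some score does; the length condition places
    \<open>X \<omega>\<close> in \<open>T\<close>.\<close>
  have "{\<omega> \<in> space P. Max ((\<lambda>i. S (X \<omega>) (sk i) \<omega> - ES) ` {1..M}) \<ge> t} = space P - ?E"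
    using \<open>M \<ge> 1\<close> len by (auto simp: Max_ge_iff S_h J_def T_def not_less)
  then show "\<P>(\<omega> in P. Max ((\<lambda>i. S (X \<omega>) (sk i) \<omega> - ES) ` {1..M}) \<ge> t) = 1 - (1 - p\<^sub>0 t) ^ M"
    using prob_compl[of ?E] fin below_events by (simp add: prob_E)
qed

end
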